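(* Let $n\in\mathbb{N}$. The space $\mathrm{UC}(\mathbb{R}^n)\cap L^\infty(\mathbb{R}^n)$ of bounded uniformly continuous functions is not dense in $\mathrm{VMO}(\mathbb{R}^n)$.
   Context: All functions are complex-valued; $\mathrm{UC}(\mathbb{R}^n)$ is the space of uniformly continuous functions on $\mathbb{R}^n$. $\mathrm{BMO}(\mathbb{R}^n)$ is the space of $f\in L^1_{\rm loc}(\mathbb{R}^n)$ with $\|f\|_{\mathrm{BMO}(\mathbb{R}^n)}:=\sup_Q|Q|^{-1}\int_Q|f-f_Q|\,dx<\infty$, the supremum being over all cubes $Q\subset\mathbb{R}^n$ with sides parallel to the axes, where $f_Q:=|Q|^{-1}\int_Qf$. $\mathrm{VMO}(\mathbb{R}^n)$ is the space of $f\in\mathrm{BMO}(\mathbb{R}^n)$ with $\lim_{r\to0^+}\sup_{\ell(Q)\le r}|Q|^{-1}\int_Q|f-f_Q|\,dx=0$, where $\ell(Q)$ is the side-length of $Q$. Density in $\mathrm{VMO}(\mathbb{R}^n)$ is with respect to the seminorm $\|\cdot\|_{\mathrm{BMO}(\mathbb{R}^n)}$. *)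

theory Defs
  imports "HOL-Analysis.Analysis"
begin

text \<open>Functions are genuine functions, not almost-everywhere classes.  All integrals are Bochner
  integrals with respect to the completed Lebesgue measure on \<open>\<real>\<^sup>n\<close>, rendered as \<open>real ^ 'n\<close>.\<close>

definition L1_loc :: "(real ^ 'n \<Rightarrow> complex) set" where
  "L1_loc = {f. \<forall>K. compact K \<longrightarrow> set_integrable lebesgue K f}"

definition L_infty :: "(real ^ 'n \<Rightarrow> complex) set" where
  "L_infty = {f. f \<in> borel_measurable lebesgue \<and> (\<exists>C::real. AE x in lebesgue. norm (f x) \<le> C)}"

definition UC :: "(real ^ 'n \<Rightarrow> complex) set" where
  "UC = {f. uniformly_continuous_on UNIV f}"

definition cube :: "real ^ 'n \<Rightarrow> real \<Rightarrow> (real ^ 'n) set" where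
  "cube a l = {x. \<forall>i. a $ i \<le> x $ i \<and> x $ i \<le> a $ i + l}"

definition mean_on :: "(real ^ 'n) set \<Rightarrow> (real ^ 'n \<Rightarrow> complex) \<Rightarrow> complex" where
  "mean_on Q f = (LINT x:Q|lebesgue. f x) /\<^sub>R measure lebesgue Q"

text \<open>Meaningful only for \<open>f \<in> L1_loc\<close>: the Bochner integral of a non-integrable function is 0.\<close>

definition mean_osc :: "(real ^ 'n \<Rightarrow> complex) \<Rightarrow> (real ^ 'n) set \<Rightarrow> real" where
  "mean_osc f Q = (LINT x:Q|lebesgue. norm (f x - mean_on Q f)) / measure lebesgue Q"

text \<open>The suprema are taken in \<open>[0, \<infinity>]\<close>, so that an infinite value is not lost.\<close>

definition BMO_norm :: "(real ^ 'n \<Rightarrow> complex) \<Rightarrow> ennreal" where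
  "BMO_norm f = (SUP (a, l) \<in> UNIV \<times> {0<..}. ennreal (mean_osc f (cube a l)))"

definition BMO :: "(real ^ 'n \<Rightarrow> complex) set" where
  "BMO = {f \<in> L1_loc. BMO_norm f < \<infinity>}"

definition VMO :: "(real ^ 'n \<Rightarrow> complex) set" where
  "VMO = {f \<in> BMO.
     ((\<lambda>r. SUP (a, l) \<in> UNIV \<times> {0<..r}. ennreal (mean_osc f (cube a l))) \<longlongrightarrow> 0) (at_right 0)}"

definition BMO_dense_in ::
    "(real ^ 'n \<Rightarrow> complex) set \<Rightarrow> (real ^ 'n \<Rightarrow> complex) set \<Rightarrow> bool" where
  "BMO_dense_in A X \<longleftrightarrow>
     (\<forall>f\<in>X. \<forall>\<epsilon>::real. \<epsilon> > 0 \<longrightarrow> (\<exists>g\<in>A. BMO_norm (\<lambda>x. f x - g x) < ennreal \<epsilon>))"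

end

(* The witness is f x = ln (1 + |x|).  It is 1-Lipschitz, which controls its oscillation on small
   cubes.  On a cube far from the origin, relative to its side-length, f varies by a bounded amount;
   on a cube Q near the origin with 1 + |x| <= R on Q, a layer-cake sum over the sets
   {1 + |x| <= R exp (-k)} bounds the mean of ln R - f.  Hence f is in VMO.

   If g is bounded and h = f - g has small BMO norm eps, comparing nested cubes of doubled side shows
   that the mean of h over [2^K, 2^(K+1)]^n is at most C + (K + 2) 2^n eps.  But the mean of f there
   is at least K ln 2, and g contributes only a bounded amount: a contradiction for large K. *)

theory Submission
  imports Defs
begin

section \<open>Means and mean oscillation on sets of positive finite measure\<close>

lemma set_integrable_const:
  fixes c :: "'a::{banach, second_countable_topology}"
  assumes "Q \<in> fmeasurable M"
  shows "set_integrable M Q (\<lambda>x. c)"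
  using assms by (simp add: set_integrable_def fmeasurable_def)

lemma set_integral_const_fmeasurable:
  fixes c :: "'a::{banach, second_countable_topology}"
  assumes "Q \<in> fmeasurable M"
  shows "(LINT x:Q|M. c) = measure M Q *\<^sub>R c"
  using assms by (intro set_integral_const) (auto simp: fmeasurable_def)

lemma norm_mean_on_diff_le:
  fixes h :: "real ^ 'n \<Rightarrow> complex"
  assumes Q: "Q \<in> lmeasurable" "measure lebesgue Q > 0" and h: "set_integrable lebesgue Q h"
  shows "norm (mean_on Q h - c) \<le> (LINT x:Q|lebesgue. norm (h x - c)) / measure lebesgue Q"
proof -
  have c: "set_integrable lebesgue Q (\<lambda>x. c)"
    by (rule set_integrable_const[OF Q(1)])
  have "(LINT x:Q|lebesgue. h x - c) = (LINT x:Q|lebesgue. h x) - measure lebesgue Q *\<^sub>R c"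
    using Q h c by (simp add: set_integral_const_fmeasurable)
  then have "mean_on Q h - c = (LINT x:Q|lebesgue. h x - c) /\<^sub>R measure lebesgue Q"
    using Q by (simp add: mean_on_def scaleR_diff_right)
  then have "norm (mean_on Q h - c) = norm (LINT x:Q|lebesgue. h x - c) / measure lebesgue Q"
    using Q by (simp add: divide_inverse mult.commute)
  also have "\<dots> \<le> (LINT x:Q|lebesgue. norm (h x - c)) / measure lebesgue Q"
    using Q set_integral_diff(1)[OF h c] by (intro divide_right_mono set_integral_norm_bound) auto
  finally show ?thesis .
qed

text \<open>Bound the deviation on \<open>Q'\<close> from the constant \<open>mean_on Q h\<close>,
  then enlarge the domain of integration of the nonnegative deviation to \<open>Q\<close>. The ratio
  of measures accounts for averaging over \<open>Q'\<close> instead of \<open>Q\<close>.\<close>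

lemma norm_mean_on_nested_le:
  fixes h :: "real ^ 'n \<Rightarrow> complex"
  assumes Q: "Q \<in> lmeasurable" "measure lebesgue Q > 0" and h: "set_integrable lebesgue Q h"
    and Q': "Q' \<in> lmeasurable" "measure lebesgue Q' > 0" "Q' \<subseteq> Q"
  shows "norm (mean_on Q' h - mean_on Q h) \<le> measure lebesgue Q / measure lebesgue Q' * mean_osc h Q"
proof -
  let ?d = "\<lambda>x. norm (h x - mean_on Q h)"
  have h': "set_integrable lebesgue Q' h"
    using set_integrable_subset[OF h _ Q'(3)] Q'(1) by (simp add: fmeasurable_def)
  have d: "set_integrable lebesgue Q ?d"
    by (intro set_integrable_norm set_integral_diff h set_integrable_const Q)
  have "(LINT x:Q'|lebesgue. ?d x) \<le> (LINT x:Q|lebesgue. ?d x)"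
    unfolding set_lebesgue_integral_def
  proof (rule integral_mono)
    have "set_integrable lebesgue Q' ?d"
      using set_integrable_subset[OF d _ Q'(3)] Q'(1) by (simp add: fmeasurable_def)
    then show "integrable lebesgue (\<lambda>x. indicator Q' x *\<^sub>R ?d x)"
      by (simp add: set_integrable_def)
    show "integrable lebesgue (\<lambda>x. indicator Q x *\<^sub>R ?d x)"
      using d by (simp add: set_integrable_def)
    show "indicator Q' x *\<^sub>R ?d x \<le> indicator Q x *\<^sub>R ?d x" for x
      using Q'(3) by (auto simp: indicator_def)
  qed
  then have "norm (mean_on Q' h - mean_on Q h) \<le> (LINT x:Q|lebesgue. ?d x) / measure lebesgue Q'"
    using norm_mean_on_diff_le[OF Q'(1,2) h', of "mean_on Q h"] Q'(2)
    by (meson divide_right_mono less_imp_le order_trans)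
  then show ?thesis
    using Q by (simp add: mean_osc_def)
qed

text \<open>Any constant \<open>c\<close> may stand in for the mean at the cost of a factor 2: the
  mean itself lies within \<open>B\<close> of \<open>c\<close>, so the triangle inequality adds at
  most another \<open>B\<close>.\<close>

lemma mean_osc_le:
  fixes f :: "real ^ 'n \<Rightarrow> complex"
  assumes Q: "Q \<in> lmeasurable" "measure lebesgue Q > 0" and f: "set_integrable lebesgue Q f"
    and B: "(LINT x:Q|lebesgue. norm (f x - c)) \<le> B * measure lebesgue Q"
  shows "mean_osc f Q \<le> 2 * B"
proof -
  define m where "m = mean_on Q f"
  have "norm (m - c) \<le> (LINT x:Q|lebesgue. norm (f x - c)) / measure lebesgue Q"
    unfolding m_def by (rule norm_mean_on_diff_le[OF Q f])
  also have "\<dots> \<le> B"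
    using Q B by (simp add: divide_le_eq)
  finally have m: "norm (m - c) \<le> B" .
  have int: "set_integrable lebesgue Q (\<lambda>x. norm (f x - d))" for d
    by (intro set_integrable_norm set_integral_diff f set_integrable_const Q)
  have intB: "set_integrable lebesgue Q (\<lambda>x. B)"
    by (rule set_integrable_const[OF Q(1)])
  have "norm (f x - m) \<le> norm (f x - c) + B" for x
    using m norm_triangle_ineq[of "f x - c" "c - m"] by (simp add: norm_minus_commute)
  then have "(LINT x:Q|lebesgue. norm (f x - m)) \<le> (LINT x:Q|lebesgue. norm (f x - c) + B)"
    by (intro set_integral_mono int set_integral_add intB)
  also have "\<dots> = (LINT x:Q|lebesgue. norm (f x - c)) + B * measure lebesgue Q"
    using Q by (simp add: set_integral_add(2)[OF int intB] set_integral_const_fmeasurable)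
  finally show ?thesis
    using B Q by (simp add: mean_osc_def m_def divide_le_eq)
qed

lemma mean_osc_le_of_bound:
  fixes f :: "real ^ 'n \<Rightarrow> complex"
  assumes Q: "Q \<in> lmeasurable" "measure lebesgue Q > 0" and f: "set_integrable lebesgue Q f"
    and B: "\<And>x. x \<in> Q \<Longrightarrow> norm (f x - c) \<le> B"
  shows "mean_osc f Q \<le> 2 * B"
proof (rule mean_osc_le[OF Q f])
  have "(LINT x:Q|lebesgue. norm (f x - c)) \<le> (LINT x:Q|lebesgue. B)"
    by (intro set_integral_mono set_integrable_norm set_integral_diff f set_integrable_const Q B)
  then show "(LINT x:Q|lebesgue. norm (f x - c)) \<le> B * measure lebesgue Q"
    using Q by (simp add: set_integral_const_fmeasurable mult.commute)
qed

section \<open>Cubes, and uniformly continuous functions on them\<close>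

lemma cube_eq_cbox: "cube a l = cbox a (\<chi> i. a $ i + l)"
  by (auto simp: cube_def mem_box_cart)

lemma lmeasurable_cube: "cube a l \<in> lmeasurable"
  by (simp add: cube_eq_cbox)

lemma measure_cube:
  fixes a :: "real ^ 'n"
  assumes "l \<ge> 0"
  shows "measure lebesgue (cube a l) = l ^ CARD('n)"
proof -
  have "cbox a (\<chi> i. a $ i + l) \<noteq> {}"
    using assms by (simp add: interval_ne_empty_cart)
  then show ?thesis
    by (simp add: cube_eq_cbox content_cbox_cart)
qed

lemma cube_subset:
  assumes "\<And>i. b $ i \<le> a $ i" "\<And>i. a $ i + l \<le> b $ i + m"
  shows "cube a l \<subseteq> cube b m"
  unfolding cube_def using assms by (blast intro: order_trans)

lemma norm_diff_cube:
  fixes a :: "real ^ 'n"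
  assumes "x \<in> cube a l"
  shows "norm (x - a) \<le> real CARD('n) * l"
proof -
  have "norm (x - a) \<le> (\<Sum>i\<in>UNIV. \<bar>(x - a) $ i\<bar>)"
    by (rule norm_le_l1_cart)
  also have "\<dots> \<le> (\<Sum>i\<in>(UNIV::'n set). l)"
  proof (rule sum_mono)
    fix i
    have "a $ i \<le> x $ i" "x $ i \<le> a $ i + l"
      using assms by (auto simp: cube_def)
    then show "\<bar>(x - a) $ i\<bar> \<le> l" by simp
  qed
  finally show ?thesis by simp
qed

text \<open>A compact set lies in a box, on which continuity gives integrability. The witness and
  its approximants are all uniformly continuous, so their integrals over cubes are genuine and not
  the default value 0.\<close>

lemma UC_subset_L1_loc: "UC \<subseteq> (L1_loc :: (real ^ 'n \<Rightarrow> complex) set)"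
proof
  fix f :: "real ^ 'n \<Rightarrow> complex" assume "f \<in> UC"
  then have cont: "continuous_on A f" for A
    by (metis UC_def mem_Collect_eq uniformly_continuous_imp_continuous continuous_on_subset subset_UNIV)
  show "f \<in> L1_loc"
    unfolding L1_loc_def
  proof safe
    fix K :: "(real ^ 'n) set" assume K: "compact K"
    then obtain a where "K \<subseteq> cbox (-a) a"
      using bounded_subset_cbox_symmetric compact_imp_bounded by blast
    then show "set_integrable lebesgue K f"
      using set_integrable_subset[OF absolutely_integrable_continuous[OF cont]] K
      by (simp add: compact_imp_closed)
  qed
qed

lemma set_integrable_cube_UC:
  assumes "f \<in> UC"
  shows "set_integrable lebesgue (cube a l) f"
proof -
  have "f \<in> L1_loc" using assms UC_subset_L1_loc by blast
  then show ?thesis by (simp add: L1_loc_def cube_eq_cbox)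
qed

lemma mean_osc_cube_le_BMO_norm:
  assumes "l > 0"
  shows "ennreal (mean_osc f (cube a l)) \<le> BMO_norm f"
  unfolding BMO_norm_def using assms by (intro SUP_upper2[of "(a, l)"]) auto

section \<open>The witness and its modulus of continuity\<close>

text \<open>The classical unbounded BMO function \<open>ln |x|\<close> with its singularity at the
  origin removed: the shift by 1 makes it Lipschitz and keeps the logarithmic growth at
  infinity.\<close>

definition log_norm :: "real ^ 'n \<Rightarrow> complex" where
  "log_norm x = of_real (ln (1 + norm x))"

lemma ln_diff_le:
  fixes p q :: real
  assumes "p > 0" "q > 0"
  shows "ln p - ln q \<le> (p - q) / q"
proof -
  have "ln p - ln q = ln (p / q)" using assms by (simp add: ln_div)
  also have "\<dots> \<le> p / q - 1" using assms by (intro ln_le_minus_one) simp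
  finally show ?thesis using assms by (simp add: diff_divide_distrib)
qed

text \<open>The slope of \<open>ln\<close> is at most \<open>1 / m\<close> beyond \<open>m\<close>.
  Taking \<open>m = 1\<close> gives the Lipschitz bound for small cubes; taking \<open>m\<close>
  comparable to the side-length gives bounded variation on distant cubes.\<close>

lemma log_norm_diff:
  fixes x y :: "real ^ 'n"
  assumes "m > 0" "m \<le> 1 + norm x" "m \<le> 1 + norm y"
  shows "norm (log_norm x - log_norm y) \<le> norm (x - y) / m"
proof -
  have *: "ln (1 + norm u) - ln (1 + norm v) \<le> norm (u - v) / m"
    if "m \<le> 1 + norm v" for u v :: "real ^ 'n"
  proof -
    have "ln (1 + norm u) - ln (1 + norm v) \<le> (norm u - norm v) / (1 + norm v)"
      using ln_diff_le[of "1 + norm u" "1 + norm v"] by (simp add: add_pos_nonneg)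
    also have "\<dots> \<le> norm (u - v) / (1 + norm v)"
      by (intro divide_right_mono norm_triangle_ineq2) simp
    also have "\<dots> \<le> norm (u - v) / m"
      using that assms(1) by (intro divide_left_mono) auto
    finally show ?thesis .
  qed
  have "norm (log_norm x - log_norm y) = \<bar>ln (1 + norm x) - ln (1 + norm y)\<bar>"
    by (simp add: log_norm_def flip: of_real_diff)
  then show ?thesis
    using *[OF assms(3), of x] *[OF assms(2), of y] by (simp add: norm_minus_commute abs_le_iff)
qed

lemma log_norm_UC: "log_norm \<in> UC"
  unfolding UC_def mem_Collect_eq uniformly_continuous_on_def
proof (intro allI impI)
  fix e :: real assume "e > 0"
  moreover have "dist (log_norm x) (log_norm y) \<le> dist x y" for x y :: "real ^ 'n"
    using log_norm_diff[of 1 x y] by (simp add: dist_norm)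
  ultimately show "\<exists>d>0. \<forall>x\<in>UNIV. \<forall>x'\<in>UNIV. dist x' x < d \<longrightarrow>
      dist (log_norm x' :: complex) (log_norm (x :: real ^ 'n)) < e"
    by (meson le_less_trans)
qed

section \<open>Layer-cake estimate near the origin\<close>

lemma sum_exp_neg_le_2: "(\<Sum>k\<le>N. exp (- real k)) \<le> 2"
proof -
  have "exp (- real k) \<le> (1/2) ^ k" for k
  proof -
    have "2 \<le> exp (1::real)" using exp_ge_add_one_self[of 1] by simp
    then have "exp (- 1 :: real) \<le> 1 / 2"
      by (simp add: exp_minus field_simps)
    then have "exp (- 1 :: real) ^ k \<le> (1/2) ^ k" by (intro power_mono) auto
    then show ?thesis by (simp flip: exp_of_nat_mult)
  qed
  then have "(\<Sum>k\<le>N. exp (- real k)) \<le> (\<Sum>k\<le>N. (1/2) ^ k)" by (rule sum_mono)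
  also have "\<dots> = 2 - (1/2) ^ N" by (induction N) (auto simp: field_simps)
  also have "\<dots> \<le> 2" by simp
  finally show ?thesis .
qed

text \<open>Discrete layer cake: for \<open>0 \<le> s \<le> N\<close> at least \<open>s\<close> of
  the integers from 0 to \<open>N\<close> are at most \<open>s\<close>, because 0 is counted
  too.\<close>

lemma le_count_indicator:
  fixes s :: real
  assumes "s \<le> real N"
  shows "s \<le> (\<Sum>k\<le>N. if real k \<le> s then 1 else 0)"
  using assms
proof (induction N arbitrary: s)
  case (Suc N)
  show ?case
  proof (cases "s \<le> real N")
    case True
    then show ?thesis using Suc.IH[of s] by (simp add: add_increasing2)
  next
    case False
    have "(\<Sum>k\<le>N. if real k \<le> s then 1 else 0 :: real) = (\<Sum>k\<le>N. 1)"
      using False by (intro sum.cong) auto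
    then show ?thesis using Suc.prems by auto
  qed
qed auto

text \<open>The integrand \<open>ln R - ln (1 + |x|)\<close> is at most the number of
  \<open>k\<close> with \<open>1 + |x| \<le> R * exp (- k)\<close>. Each such set lies in a cube of
  half-side \<open>R * exp (- k)\<close>, and the measures of these cubes have a sum bounded
  independently of \<open>N\<close>.\<close>

lemma log_norm_integral_le:
  fixes Q :: "(real ^ 'n) set"
  assumes Q: "Q \<in> lmeasurable" and R: "R \<ge> 1" "\<And>x. x \<in> Q \<Longrightarrow> 1 + norm x \<le> R"
    and int: "set_integrable lebesgue Q log_norm"
  shows "(LINT x:Q|lebesgue. norm (log_norm x - of_real (ln R))) \<le> 2 * (2 * R) ^ CARD('n)"
proof -
  \<comment> \<open>Since \<open>ln (1 + |x|) \<ge> 0\<close>, the integrand never exceeds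
    \<open>ln R\<close>, so finitely many layers suffice.\<close>
  obtain N where N: "ln R \<le> real N" using real_arch_simple by blast
  define r where "r k = R * exp (- real k)" for k
  define C :: "nat \<Rightarrow> (real ^ 'n) set"
    where "C k = cube (\<chi> i. - r k) (2 * r k)" for k
  have C: "C k \<in> lmeasurable" for k by (simp add: C_def lmeasurable_cube)
  have Ck: "measure lebesgue (C k) \<le> (2 * R) ^ CARD('n) * exp (- real k)" for k
  proof -
    have "measure lebesgue (C k) = (2 * R) ^ CARD('n) * exp (- real k) ^ CARD('n)"
      using R by (simp add: C_def r_def measure_cube power_mult_distrib)
    \<comment> \<open>As the dimension is at least 1, the decay is at least that of
      \<open>exp (- k)\<close>, whose sum is bounded by 2.\<close>
    also have "\<dots> \<le> (2 * R) ^ CARD('n) * exp (- real k) ^ 1"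
      using R by (intro mult_left_mono power_decreasing) (auto simp: Suc_leI)
    finally show ?thesis by simp
  qed
  have bound: "indicator Q x *\<^sub>R norm (log_norm x - of_real (ln R)) \<le> (\<Sum>k\<le>N. indicator (C k) x :: real)" for x
  proof (cases "x \<in> Q")
    case True
    define s where "s = ln R - ln (1 + norm x)"
    have pos: "0 < 1 + norm x" by (simp add: add_pos_nonneg)
    have s: "s \<ge> 0" using R(2)[OF True] pos by (simp add: s_def)
    have "norm (log_norm x - complex_of_real (ln R)) = s"
      using s unfolding log_norm_def s_def by (simp flip: of_real_diff)
    moreover have "ln (1 + norm x) \<ge> 0" by (rule ln_ge_zero) simp
    then have "s \<le> real N" using N unfolding s_def by linarith
    then have "s \<le> (\<Sum>k\<le>N. if real k \<le> s then 1 else 0)" by (rule le_count_indicator)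
    moreover have "\<dots> \<le> (\<Sum>k\<le>N. indicator (C k) x)"
    proof (rule sum_mono)
      fix k
      have "x \<in> C k" if "real k \<le> s"
      proof -
        have "ln (1 + norm x) \<le> ln (r k)"
          using that R by (simp add: s_def r_def ln_mult)
        then have "norm x \<le> r k"
          using pos R by (subst (asm) ln_le_cancel_iff) (auto simp: r_def)
        then have "- r k \<le> x $ i \<and> x $ i \<le> r k" for i
          using component_le_norm_cart[of x i] by linarith
        then show ?thesis by (simp add: C_def cube_def)
      qed
      then show "(if real k \<le> s then 1 else 0) \<le> (indicator (C k) x :: real)" by auto
    qed
    ultimately show ?thesis using True by simp
  qed (simp add: sum_nonneg)
  have intC: "integrable lebesgue (indicator (C k) :: _ \<Rightarrow> real)" for k
    using set_integrable_const[OF C, of k "1 :: real"] by (simp add: set_integrable_def)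
  have "(LINT x:Q|lebesgue. norm (log_norm x - of_real (ln R)))
      \<le> (LINT x|lebesgue. (\<Sum>k\<le>N. indicator (C k) x))"
    unfolding set_lebesgue_integral_def
  proof (rule integral_mono[OF _ _ bound])
    have "set_integrable lebesgue Q (\<lambda>x. norm (log_norm x - complex_of_real (ln R)))"
      by (intro set_integrable_norm set_integral_diff int set_integrable_const Q)
    then show "integrable lebesgue (\<lambda>x. indicator Q x *\<^sub>R norm (log_norm x - complex_of_real (ln R)))"
      by (simp add: set_integrable_def)
  qed (use intC in auto)
  also have "\<dots> = (\<Sum>k\<le>N. measure lebesgue (C k))"
    using intC by (simp add: Bochner_Integration.integral_sum)
  also have "\<dots> \<le> (\<Sum>k\<le>N. (2 * R) ^ CARD('n) * exp (- real k))"
    by (intro sum_mono Ck)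
  also have "\<dots> \<le> (2 * R) ^ CARD('n) * 2"
    unfolding sum_distrib_left[symmetric] using R by (intro mult_left_mono sum_exp_neg_le_2) auto
  finally show ?thesis by simp
qed

section \<open>Mean oscillation of the witness and membership in VMO\<close>

text \<open>Compare with the value at the corner \<open>a\<close> by the Lipschitz bound. Being
  linear in \<open>l\<close>, the estimate yields the vanishing condition of VMO as well as the BMO
  bound for \<open>l \<le> 1\<close>.\<close>

lemma mean_osc_log_norm_small:
  fixes a :: "real ^ 'n"
  assumes "l > 0"
  shows "mean_osc log_norm (cube a l) \<le> 2 * (real CARD('n) * l)"
proof (rule mean_osc_le_of_bound)
  show "norm (log_norm x - log_norm a) \<le> real CARD('n) * l" if "x \<in> cube a l" for x
    using log_norm_diff[of 1 x a] norm_diff_cube[OF that] by simp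
  show "set_integrable lebesgue (cube a l) log_norm"
    by (rule set_integrable_cube_UC[OF log_norm_UC])
qed (use assms in \<open>simp_all add: lmeasurable_cube measure_cube\<close>)

lemma mean_osc_log_norm_le:
  fixes a :: "real ^ 'n"
  assumes l: "l > 0"
  shows "mean_osc log_norm (cube a l) \<le> 4 * (8 * real CARD('n)) ^ CARD('n)"
proof -
  define n where "n = real CARD('n)"
  have n: "n \<ge> 1" by (simp add: n_def Suc_leI)
  \<comment> \<open>Lets the final constant absorb the bounds \<open>2 * n\<close> and 2 of the
    first two cases below.\<close>
  have n8: "8 * n \<le> (8 * n) ^ CARD('n)"
    using n power_increasing[of 1 "CARD('n)" "8 * n"] by (simp add: Suc_leI)
  have int: "set_integrable lebesgue (cube a l) log_norm"
    by (rule set_integrable_cube_UC[OF log_norm_UC])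
  have Q: "cube a l \<in> lmeasurable" "measure lebesgue (cube a l) > 0"
    using l by (simp_all add: lmeasurable_cube measure_cube)
  \<comment> \<open>Points of the cube lie within \<open>n * l\<close> of \<open>a\<close>. Hence in
    the second case they all have norm at least \<open>n * l\<close>, and in the third at most
    \<open>3 * n * l\<close>.\<close>
  consider "l \<le> 1" | "l \<ge> 1" "norm a \<ge> 2 * n * l" | "l \<ge> 1" "norm a \<le> 2 * n * l" by linarith
  then show ?thesis
  proof cases
    case 1
    then have "n * l \<le> n" using n by (simp add: mult_left_le)
    then show ?thesis using mean_osc_log_norm_small[OF l, of a] n8 n unfolding n_def by linarith
  next
    case 2
    have "mean_osc log_norm (cube a l) \<le> 2 * 1"
    proof (rule mean_osc_le_of_bound[OF Q int])
      fix x assume "x \<in> cube a l"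
      then have d: "norm (x - a) \<le> n * l" using norm_diff_cube n_def by blast
      have nl: "n * l > 0" using n l by simp
      have "norm a \<le> norm x + norm (x - a)"
        by (metis norm_minus_commute norm_triangle_sub)
      then have "norm (log_norm x - log_norm a) \<le> norm (x - a) / (n * l)"
        using d nl 2(2) by (intro log_norm_diff) linarith+
      then show "norm (log_norm x - log_norm a) \<le> 1"
        using d nl by (meson divide_le_eq_1_pos order_trans)
    qed
    then show ?thesis using n8 n unfolding n_def by linarith
  next
    case 3
    \<comment> \<open>\<open>4 * n * l\<close> is the bound \<open>3 * n * l\<close> on the norm
      plus one more \<open>n * l \<ge> 1\<close> for the shift in \<open>1 + |x|\<close>. Then
      \<open>(2 * R) ^ n\<close> is a multiple of the measure of the cube with a factor independent
      of \<open>l\<close>.\<close>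
    define R where "R = 4 * n * l"
    have nl: "n * l \<ge> 1" using n 3(1) mult_mono[of 1 n 1 l] by simp
    have R: "1 + norm x \<le> R" if "x \<in> cube a l" for x
    proof -
      have "norm x \<le> norm a + norm (x - a)" by (simp add: norm_triangle_sub)
      then show ?thesis
        using norm_diff_cube[OF that] 3(2) nl unfolding R_def n_def[symmetric] by linarith
    qed
    have "(LINT x:cube a l|lebesgue. norm (log_norm x - of_real (ln R))) \<le> 2 * (2 * R) ^ CARD('n)"
      using nl R by (intro log_norm_integral_le Q int) (auto simp: R_def)
    also have "\<dots> = (2 * (8 * n) ^ CARD('n)) * measure lebesgue (cube a l)"
    proof -
      have "(2 * R) ^ CARD('n) = (8 * n) ^ CARD('n) * l ^ CARD('n)"
        unfolding R_def power_mult_distrib[symmetric] by (simp add: mult.assoc)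
      then show ?thesis using l by (simp add: measure_cube)
    qed
    finally have "mean_osc log_norm (cube a l) \<le> 2 * (2 * (8 * n) ^ CARD('n))"
      by (rule mean_osc_le[OF Q int])
    then show ?thesis
      unfolding n_def by linarith
  qed
qed

lemma log_norm_VMO: "(log_norm :: real ^ 'n \<Rightarrow> complex) \<in> VMO"
proof -
  have "BMO_norm (log_norm :: real ^ 'n \<Rightarrow> complex) \<le> ennreal (4 * (8 * real CARD('n)) ^ CARD('n))"
    unfolding BMO_norm_def
    by (rule SUP_least, clarify, rule ennreal_leI, rule mean_osc_log_norm_le) simp
  then have "BMO_norm (log_norm :: real ^ 'n \<Rightarrow> complex) < \<infinity>"
    by (rule le_less_trans) simp
  then have BMO: "(log_norm :: real ^ 'n \<Rightarrow> complex) \<in> BMO"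
    using log_norm_UC UC_subset_L1_loc by (auto simp: BMO_def)
  define S where "S r = (SUP (a :: real ^ 'n, l) \<in> UNIV \<times> {0<..r}. ennreal (mean_osc log_norm (cube a l)))" for r
  have S: "S r \<le> ennreal (2 * (real CARD('n) * r))" for r
    unfolding S_def
  proof (rule SUP_least, clarify, rule ennreal_leI)
    fix a :: "real ^ 'n" and l :: real assume l: "l \<in> {0<..r}"
    then have "mean_osc log_norm (cube a l) \<le> 2 * (real CARD('n) * l)"
      by (intro mean_osc_log_norm_small) auto
    also have "\<dots> \<le> 2 * (real CARD('n) * r)" using l by (auto intro!: mult_left_mono)
    finally show "mean_osc log_norm (cube a l) \<le> 2 * (real CARD('n) * r)" .
  qed
  have "((\<lambda>r. 2 * (real CARD('n) * r)) \<longlongrightarrow> 2 * (real CARD('n) * 0)) (at_right 0)"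
    by (intro tendsto_intros)
  from tendsto_ennrealI[OF this] have upper: "((\<lambda>r. ennreal (2 * (real CARD('n) * r))) \<longlongrightarrow> 0) (at_right 0)"
    by simp
  have "(S \<longlongrightarrow> 0) (at_right 0)"
    by (rule tendsto_sandwich[OF _ _ tendsto_const upper]) (simp_all add: S)
  then show ?thesis
    using BMO by (simp add: VMO_def S_def[abs_def])
qed

section \<open>Growth of means, and the contradiction for bounded approximants\<close>

lemma norm_mean_on_le:
  fixes g :: "real ^ 'n \<Rightarrow> complex"
  assumes Q: "Q \<in> lmeasurable" "measure lebesgue Q > 0" and g: "set_integrable lebesgue Q g"
    and C: "AE x in lebesgue. norm (g x) \<le> C"
  shows "norm (mean_on Q g) \<le> C"
proof -
  have "norm (mean_on Q g) \<le> (LINT x:Q|lebesgue. norm (g x)) / measure lebesgue Q"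
    using norm_mean_on_diff_le[OF Q g, of 0] by simp
  also have "(LINT x:Q|lebesgue. norm (g x)) \<le> (LINT x:Q|lebesgue. C)"
    using C by (intro set_integral_mono_AE set_integrable_norm g set_integrable_const Q) auto
  also have "\<dots> = C * measure lebesgue Q"
    using Q by (simp add: set_integral_const_fmeasurable)
  finally show ?thesis using Q by (simp add: divide_right_mono)
qed

text \<open>The witness is real-valued, so averaging preserves the lower bound for the real part of
  the mean, which is at most its modulus.\<close>

lemma mean_on_log_norm_ge:
  fixes a :: "real ^ 'n"
  assumes "l > 0" and b: "\<And>x. x \<in> cube a l \<Longrightarrow> b \<le> ln (1 + norm x)"
  shows "b \<le> norm (mean_on (cube a l) log_norm)"
proof -
  let ?Q = "cube a l"
  have Q: "?Q \<in> lmeasurable" "measure lebesgue ?Q > 0"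
    using assms(1) by (simp_all add: lmeasurable_cube measure_cube)
  have int: "set_integrable lebesgue ?Q log_norm"
    by (rule set_integrable_cube_UC[OF log_norm_UC])
  have int': "set_integrable lebesgue ?Q (\<lambda>x. ln (1 + norm x))"
    using int unfolding set_integrable_def log_norm_def
    by (simp add: scaleR_conv_of_real complex_of_real_integrable_eq flip: of_real_mult)
  have "b * measure lebesgue ?Q = (LINT x:?Q|lebesgue. b)"
    using Q by (simp add: set_integral_const_fmeasurable)
  also have "\<dots> \<le> (LINT x:?Q|lebesgue. ln (1 + norm x))"
    by (intro set_integral_mono set_integrable_const Q int' b)
  finally have "b \<le> (LINT x:?Q|lebesgue. ln (1 + norm x)) / measure lebesgue ?Q"
    using Q by (simp add: le_divide_eq)
  also have "\<dots> = Re (mean_on ?Q log_norm)"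
    by (simp add: mean_on_def log_norm_def[abs_def] set_integral_complex_of_real divide_inverse)
  also have "\<dots> \<le> norm (mean_on ?Q log_norm)"
    by (rule complex_Re_le_cmod)
  finally show ?thesis .
qed

theorem theorem1p8:
  shows "\<not> BMO_dense_in (UC \<inter> L_infty) (VMO :: (real ^ 'n \<Rightarrow> complex) set)"
proof
  assume dense: "BMO_dense_in (UC \<inter> L_infty) (VMO :: (real ^ 'n \<Rightarrow> complex) set)"
  \<comment> \<open>Doubling the side multiplies the measure by \<open>2 ^ n\<close>, so this choice
    makes each comparison of nested cubes cost exactly 1/4.\<close>
  define \<epsilon> :: real where "\<epsilon> = 1 / (4 * 2 ^ CARD('n))"
  have "\<epsilon> > 0" by (simp add: \<epsilon>_def)
  with dense obtain g :: "real ^ 'n \<Rightarrow> complex"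
    where g: "g \<in> UC" "g \<in> L_infty" and lt: "BMO_norm (\<lambda>x. log_norm x - g x) < ennreal \<epsilon>"
    using log_norm_VMO unfolding BMO_dense_in_def by blast
  define h where "h = (\<lambda>x. log_norm x - g x)"
  obtain C where C: "AE x in lebesgue. norm (g x) \<le> C"
    using g(2) by (auto simp: L_infty_def)
  have int_g: "set_integrable lebesgue (cube a l) g" for a l
    by (rule set_integrable_cube_UC[OF g(1)])
  have int_f: "set_integrable lebesgue (cube a l) (log_norm :: real ^ 'n \<Rightarrow> complex)" for a l
    by (rule set_integrable_cube_UC[OF log_norm_UC])
  have int_h: "set_integrable lebesgue (cube a l) h" for a l
    unfolding h_def by (intro set_integral_diff int_f int_g)
  have osc: "mean_osc h (cube a l) \<le> \<epsilon>" if "l > 0" for a l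
  proof -
    have "ennreal (mean_osc h (cube a l)) < ennreal \<epsilon>"
      using mean_osc_cube_le_BMO_norm[OF that, of h a] lt unfolding h_def by (rule le_less_trans)
    then show ?thesis
      using ennreal_leI[of \<epsilon> "mean_osc h (cube a l)"] by (cases "mean_osc h (cube a l) \<le> \<epsilon>") auto
  qed
  have halve: "norm (mean_on (cube a l) h - mean_on (cube b (2 * l)) h) \<le> 1 / 4"
    if "l > 0" "cube a l \<subseteq> cube b (2 * l)" for a b l
  proof -
    have "norm (mean_on (cube a l) h - mean_on (cube b (2 * l)) h)
        \<le> measure lebesgue (cube b (2 * l)) / measure lebesgue (cube a l) * mean_osc h (cube b (2 * l))"
      using that int_h by (intro norm_mean_on_nested_le) (auto simp: lmeasurable_cube measure_cube)
    also have "\<dots> = 2 ^ CARD('n) * mean_osc h (cube b (2 * l))"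
      using that by (simp add: measure_cube power_mult_distrib)
    also have "\<dots> \<le> 2 ^ CARD('n) * \<epsilon>"
      using that by (intro mult_left_mono osc) auto
    finally show ?thesis by (simp add: \<epsilon>_def)
  qed
  define A where "A = norm (mean_on (cube 0 1) h)"
  \<comment> \<open>The cubes share the corner 0, and each of the \<open>K\<close> doublings from
    the unit cube moves the mean by at most 1/4.\<close>
  have centred: "norm (mean_on (cube 0 (2 ^ K)) h) \<le> A + K / 4" for K :: nat
  proof (induction K)
    case (Suc K)
    have "cube (0 :: real ^ 'n) (2 ^ K) \<subseteq> cube 0 (2 * 2 ^ K)"
      by (rule cube_subset) auto
    then have "norm (mean_on (cube 0 (2 ^ K)) h - mean_on (cube 0 (2 * 2 ^ K)) h) \<le> 1 / 4"
      by (intro halve) auto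
    then show ?case
      using Suc.IH norm_triangle_sub[of "mean_on (cube 0 (2 * 2 ^ K)) h" "mean_on (cube 0 (2 ^ K)) h"]
      unfolding power_Suc norm_minus_commute[of "mean_on (cube 0 (2 ^ K)) h"] of_nat_Suc add_divide_distrib
      by linarith
  qed (simp add: A_def)
  have growth: "real K / 2 \<le> A + (real K + 2) / 4 + C" for K :: nat
  proof -
    \<comment> \<open>\<open>Q\<close> is the subcube of \<open>[0, 2^(K+1)]^n\<close> at the corner
      opposite the origin, where every coordinate is at least \<open>2 ^ K\<close>. Reaching it
      takes \<open>K + 1\<close> doublings and one step down, hence \<open>K + 2\<close>
      quarters.\<close>
    define a :: "real ^ 'n" where "a = (\<chi> i. 2 ^ K)"
    define Q where "Q = cube a (2 ^ K)"
    have Q: "Q \<in> lmeasurable" "measure lebesgue Q > 0"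
      by (simp_all add: Q_def lmeasurable_cube measure_cube)
    have "Q \<subseteq> cube 0 (2 * 2 ^ K)"
      unfolding Q_def by (rule cube_subset) (auto simp: a_def)
    then have "norm (mean_on Q h - mean_on (cube 0 (2 * 2 ^ K)) h) \<le> 1 / 4"
      unfolding Q_def by (intro halve) auto
    then have h: "norm (mean_on Q h) \<le> A + (real K + 2) / 4"
      using centred[of "Suc K"] norm_triangle_ineq2[of "mean_on Q h" "mean_on (cube 0 (2 * 2 ^ K)) h"]
      by (simp add: field_simps)
    have diff: "mean_on Q h = mean_on Q log_norm - mean_on Q g"
      unfolding mean_on_def h_def Q_def
      by (simp add: set_integral_diff(2)[OF int_f int_g] scaleR_diff_right)
    have "norm (mean_on Q g) \<le> C"
      using int_g C Q unfolding Q_def by (intro norm_mean_on_le)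
    moreover have "real K / 2 \<le> norm (mean_on Q log_norm)"
      unfolding Q_def
    proof (rule mean_on_log_norm_ge)
      fix x assume x: "x \<in> cube a (2 ^ K)"
      \<comment> \<open>Here \<open>undefined\<close> is merely some coordinate index; any one gives
        the bound.\<close>
      have "2 ^ K \<le> x $ undefined" using x by (auto simp: cube_def a_def)
      also have "\<dots> \<le> norm x" using component_le_norm_cart[of x undefined] by linarith
      finally have "ln (2 ^ K) \<le> ln (1 + norm x)" by (subst ln_le_cancel_iff) (auto simp: add_pos_nonneg)
      \<comment> \<open>From \<open>ln 2 \<ge> 2/3\<close> only the rate 1/2 is kept, which still
        exceeds the rate 1/4 allowed to the means of \<open>h\<close>.\<close>
      moreover have "real K / 2 \<le> ln (2 ^ K)"
        using mult_left_mono[of "1/2" "ln (2::real)" "real K"] ln2_ge_two_thirds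
        by (simp add: ln_realpow)
      ultimately show "real K / 2 \<le> ln (1 + norm x)" by linarith
    qed simp
    ultimately show ?thesis
      using h[unfolded diff] norm_triangle_ineq2[of "mean_on Q log_norm" "mean_on Q g"] by linarith
  qed
  have "real K \<le> 4 * (A + C + 1)" for K :: nat
    using growth[of K] by (simp add: field_simps)
  moreover obtain K :: nat where "4 * (A + C + 1) < real K"
    using reals_Archimedean2 by blast
  ultimately show False by (meson not_less)
qed

end
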